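(* Let $E$ be a quasi-Banach ideal space with the Fatou property over $(T,\Sigma,\mu)$ and let $\varphi$ be an Orlicz function with $a_\varphi<b_\varphi$ and $\alpha^E_\varphi>0$. Assume $\mu$ is nonatomic, $L_\infty\not\subset E$ and $\operatorname{supp}(E_a)=T$. If $\varphi\notin\Delta_2(0)$, then the space $E_\varphi$ contains an order linearly isometric copy of $l_\infty$.
   Context: $(T,\Sigma,\mu)$ is a complete $\sigma$-finite measure space with $\mu(T)>0$; $L^0$ is the space of ($\mu$-a.e. classes of) real $\Sigma$-measurable functions on $T$, with the a.e. order; $L_\infty=L_\infty(T,\Sigma,\mu)$. A quasi-norm is a functional satisfying the axioms of a norm with the triangle inequality replaced by $\|x+y\|\le C(\|x\|+\|y\|)$ for some constant $C\ge1$. A quasi-Banach ideal space is a linear subspace $E\subset L^0$ with a complete quasi-norm $\|\cdot\|_E$ such that (i) $x\in L^0$, $y\in E$, $|x|\le|y|$ a.e. imply $x\in E$, $\|x\|_E\le\|y\|_E$; (ii) some $x\in E$ is strictly positive on $T$. $E$ has the Fatou property if $0\le x_n\uparrow|x|$ a.e., $x_n\in E$, $x\in L^0$, $\sup_n\|x_n\|_E<\infty$ imply $x\in E$ and $\|x_n\|_E\to\|x\|_E$. $E_a$ is the set (an order ideal) of order continuous elements: those $x\in E$ such that $\|x_n\|_E\to0$ for every sequence with $0\le x_n\le|x|$ and $x_n\to0$ a.e. The support of an order ideal $F\subset L^0$ is the smallest (up to null sets) $S\in\Sigma$ such that every $x\in F$ vanishes a.e. outside $S$. An Orlicz function is a non-decreasing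 $\varphi:[0,\infty)\to[0,\infty]$ with $\varphi(0)=0$, right continuous at $0$, continuous on $(0,b_\varphi)$ and left continuous at $b_\varphi$, where $b_\varphi=\sup\{u\ge0:\varphi(u)<\infty\}$, and with $\lim_{u\to\infty}\varphi(u)=\infty$. $a_\varphi=\sup\{u\ge0:\varphi(u)=0\}$. $\varphi\in\Delta_2(0)$ means: there are $K,u_0\in(0,\infty)$ with $\varphi(u_0)>0$ and $\varphi(2u)\le K\varphi(u)$ for all $0\le u\le u_0$. Indices: $\alpha^a_\varphi$ is the supremum of $p\in\mathbb R$ for which there is $K\ge1$ with $\varphi(au)\le Ka^p\varphi(u)$ for all $u\ge0$, $0<a\le1$; $\alpha^\infty_\varphi$ is the same with the inequality required only for $u\ge u_0$, for some $u_0>0$ with $\varphi(u_0)<\infty$; $\alpha^0_\varphi$ is the same with the inequality required only for $0\le u\le u_0$, for some $u_0>0$. $\alpha^E_\varphi=\alpha^a_\varphi$ if neither $L_\infty\subset E$ nor $E\subset L_\infty$; $\alpha^E_\varphi=\alpha^\infty_\varphi$ if $L_\infty\subset E$; $\alpha^E_\varphi=\alpha^0_\varphi$ if $E\subset L_\infty$ (if $E=L_\infty$ as sets, either of the last two). $\rho^E_\varphi(x)=\|\varphi(|x|)\|_E$ if $\varphi(|x|)\in E$, and $=\infty$ otherwise; $E_\varphi=\{x\in L^0:\rho^E_\varphi(\lambda x)<\infty\text{ for some }\lambda>0\}$ with the quasi-norm $\|x\|_\varphi=\inf\{\lambda>0:\rho^E_\varphi(x/\lambda)\le1\}$. A quasi-normed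 ideal space $F$ contains an order linearly isometric copy of $l_\infty$ if there is a linear map $P:l_\infty\to F$ with $\|Pz\|_F=\|z\|_{l_\infty}$ and $|Pz|=P|z|$ for all $z\in l_\infty$ (in particular $Pz\ge0$ when $z\ge0$). *)

theory Defs
  imports "HOL-Analysis.Analysis"
begin

text \<open>
  Elements of \<open>L\<^sup>0\<close> are represented by measurable functions, and spaces of classes by sets of such
  functions; (in)equalities between elements are understood almost everywhere. For an ideal space
  the ideal property makes both the carrier and the quasi-norm invariant under a.e. equality.
\<close>

abbreviation L0 :: "'a measure \<Rightarrow> ('a \<Rightarrow> real) set" where
  "L0 M \<equiv> borel_measurable M"

definition Linf :: "'a measure \<Rightarrow> ('a \<Rightarrow> real) set" where
  "Linf M = {x \<in> L0 M. \<exists>c. AE t in M. \<bar>x t\<bar> \<le> c}"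

text \<open>An atom is a set of positive measure that cannot be split into two non-null parts.\<close>

definition nonatomic :: "'a measure \<Rightarrow> bool" where
  "nonatomic M \<longleftrightarrow>
     (\<forall>A\<in>sets M. emeasure M A > 0 \<longrightarrow>
        (\<exists>B\<in>sets M. B \<subseteq> A \<and> emeasure M B > 0 \<and> emeasure M (A - B) > 0))"

locale quasi_banach_ideal_space =
  fixes M :: "'a measure" and E :: "('a \<Rightarrow> real) set" and N :: "('a \<Rightarrow> real) \<Rightarrow> real"
  assumes subset_L0: "E \<subseteq> L0 M"
    and zero_mem: "(\<lambda>t. 0) \<in> E"
    and add_mem: "\<lbrakk>x \<in> E; y \<in> E\<rbrakk> \<Longrightarrow> (\<lambda>t. x t + y t) \<in> E"
    and scale_mem: "x \<in> E \<Longrightarrow> (\<lambda>t. c * x t) \<in> E"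
    and norm_nonneg: "x \<in> E \<Longrightarrow> 0 \<le> N x"
    and norm_eq_0_iff: "x \<in> E \<Longrightarrow> N x = 0 \<longleftrightarrow> (AE t in M. x t = 0)"
    and norm_scale: "x \<in> E \<Longrightarrow> N (\<lambda>t. c * x t) = \<bar>c\<bar> * N x"
    and quasi_triangle:
      "\<exists>C\<ge>1. \<forall>x\<in>E. \<forall>y\<in>E. N (\<lambda>t. x t + y t) \<le> C * (N x + N y)"
    and complete:
      "\<lbrakk>\<And>n. xs n \<in> E;
        \<forall>e>0. \<exists>n0. \<forall>m\<ge>n0. \<forall>n\<ge>n0. N (\<lambda>t. xs m t - xs n t) < e\<rbrakk>
       \<Longrightarrow> \<exists>x\<in>E. (\<lambda>n. N (\<lambda>t. xs n t - x t)) \<longlonglongrightarrow> 0"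
    and ideal:
      "\<lbrakk>x \<in> L0 M; y \<in> E; AE t in M. \<bar>x t\<bar> \<le> \<bar>y t\<bar>\<rbrakk> \<Longrightarrow> x \<in> E \<and> N x \<le> N y"
    and strictly_positive: "\<exists>x\<in>E. AE t in M. 0 < x t"

definition fatou_property ::
  "'a measure \<Rightarrow> ('a \<Rightarrow> real) set \<Rightarrow> (('a \<Rightarrow> real) \<Rightarrow> real) \<Rightarrow> bool" where
  "fatou_property M E N \<longleftrightarrow>
     (\<forall>xs x. (\<forall>n. xs n \<in> E) \<and> x \<in> L0 M \<and>
        (AE t in M. (\<forall>n. 0 \<le> xs n t) \<and> incseq (\<lambda>n. xs n t) \<and> (\<lambda>n. xs n t) \<longlonglongrightarrow> \<bar>x t\<bar>) \<and>
        bdd_above (range (\<lambda>n. N (xs n)))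
      \<longrightarrow> x \<in> E \<and> (\<lambda>n. N (xs n)) \<longlonglongrightarrow> N x)"

definition order_continuous_part ::
  "'a measure \<Rightarrow> ('a \<Rightarrow> real) set \<Rightarrow> (('a \<Rightarrow> real) \<Rightarrow> real) \<Rightarrow> ('a \<Rightarrow> real) set" where
  "order_continuous_part M E N =
     {x \<in> E. \<forall>xs. (\<forall>n. xs n \<in> L0 M \<and> (AE t in M. 0 \<le> xs n t \<and> xs n t \<le> \<bar>x t\<bar>)) \<and>
                  (AE t in M. (\<lambda>n. xs n t) \<longlonglongrightarrow> 0)
                \<longrightarrow> (\<lambda>n. N (xs n)) \<longlonglongrightarrow> 0}"

text \<open>Supports are determined only up to null sets, hence a relation.\<close>

definition is_support :: "'a measure \<Rightarrow> ('a \<Rightarrow> real) set \<Rightarrow> 'a set \<Rightarrow> bool" where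
  "is_support M F S \<longleftrightarrow>
     S \<in> sets M \<and> (\<forall>x\<in>F. AE t in M. t \<notin> S \<longrightarrow> x t = 0) \<and>
     (\<forall>S'\<in>sets M. (\<forall>x\<in>F. AE t in M. t \<notin> S' \<longrightarrow> x t = 0) \<longrightarrow> S - S' \<in> null_sets M)"

text \<open>
  A function \<open>[0,\<infinity>) \<rightarrow> [0,\<infinity>]\<close> is modelled by a total function on the reals of which only the
  values at non-negative arguments are ever used.
\<close>

definition orlicz_a :: "(real \<Rightarrow> ennreal) \<Rightarrow> ereal" where
  "orlicz_a \<phi> = (SUP u\<in>{u. 0 \<le> u \<and> \<phi> u = 0}. ereal u)"

definition orlicz_b :: "(real \<Rightarrow> ennreal) \<Rightarrow> ereal" where
  "orlicz_b \<phi> = (SUP u\<in>{u. 0 \<le> u \<and> \<phi> u < \<infinity>}. ereal u)"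

text \<open>Left continuity at \<open>b\<close> is only a condition if \<open>b\<close> is finite.\<close>

definition orlicz_function :: "(real \<Rightarrow> ennreal) \<Rightarrow> bool" where
  "orlicz_function \<phi> \<longleftrightarrow>
     mono_on {0..} \<phi> \<and> \<phi> 0 = 0 \<and> continuous (at_right 0) \<phi> \<and>
     continuous_on {u. 0 < u \<and> ereal u < orlicz_b \<phi>} \<phi> \<and>
     (\<forall>b. ereal b = orlicz_b \<phi> \<longrightarrow> continuous (at_left b) \<phi>) \<and>
     (\<phi> \<longlongrightarrow> \<infinity>) at_top"

definition Delta2_at_0 :: "(real \<Rightarrow> ennreal) \<Rightarrow> bool" where
  "Delta2_at_0 \<phi> \<longleftrightarrow>
     (\<exists>K>0. \<exists>u0>0. \<phi> u0 > 0 \<and> (\<forall>u. 0 \<le> u \<and> u \<le> u0 \<longrightarrow> \<phi> (2 * u) \<le> ennreal K * \<phi> u))"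

text \<open>The estimate common to the three lower indices, for arguments \<open>u\<close> in \<open>U\<close>.\<close>

definition index_bound :: "(real \<Rightarrow> ennreal) \<Rightarrow> real set \<Rightarrow> real \<Rightarrow> bool" where
  "index_bound \<phi> U p \<longleftrightarrow>
     (\<exists>K\<ge>1. \<forall>u\<in>U. \<forall>a. 0 < a \<and> a \<le> 1 \<longrightarrow> \<phi> (a * u) \<le> ennreal (K * a powr p) * \<phi> u)"

definition alpha_a :: "(real \<Rightarrow> ennreal) \<Rightarrow> ereal" where
  "alpha_a \<phi> = (SUP p\<in>{p. index_bound \<phi> {0..} p}. ereal p)"

definition alpha_inf :: "(real \<Rightarrow> ennreal) \<Rightarrow> ereal" where
  "alpha_inf \<phi> = (SUP p\<in>{p. \<exists>u0>0. \<phi> u0 < \<infinity> \<and> index_bound \<phi> {u0..} p}. ereal p)"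

definition alpha_0 :: "(real \<Rightarrow> ennreal) \<Rightarrow> ereal" where
  "alpha_0 \<phi> = (SUP p\<in>{p. \<exists>u0>0. index_bound \<phi> {0..u0} p}. ereal p)"

text \<open>
  If \<open>E = L\<^sub>\<infinity>\<close> as sets, either of \<open>alpha_inf\<close> and \<open>alpha_0\<close> is admissible; the former is taken.
\<close>

definition alpha_E :: "'a measure \<Rightarrow> ('a \<Rightarrow> real) set \<Rightarrow> (real \<Rightarrow> ennreal) \<Rightarrow> ereal" where
  "alpha_E M E \<phi> =
     (if Linf M \<subseteq> E then alpha_inf \<phi> else if E \<subseteq> Linf M then alpha_0 \<phi> else alpha_a \<phi>)"

text \<open>
  \<open>\<phi>(|x|) \<in> E\<close> includes that \<open>\<phi>(|x|)\<close> is finite a.e.; this has to be required separately, since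
  \<open>enn2real\<close> sends \<open>\<infinity>\<close> to \<open>0\<close>.
\<close>

definition modular ::
  "'a measure \<Rightarrow> ('a \<Rightarrow> real) set \<Rightarrow> (('a \<Rightarrow> real) \<Rightarrow> real) \<Rightarrow> (real \<Rightarrow> ennreal) \<Rightarrow>
   ('a \<Rightarrow> real) \<Rightarrow> ennreal" where
  "modular M E N \<phi> x =
     (if (AE t in M. \<phi> \<bar>x t\<bar> < \<infinity>) \<and> (\<lambda>t. enn2real (\<phi> \<bar>x t\<bar>)) \<in> E
      then ennreal (N (\<lambda>t. enn2real (\<phi> \<bar>x t\<bar>))) else \<infinity>)"

definition orlicz_space ::
  "'a measure \<Rightarrow> ('a \<Rightarrow> real) set \<Rightarrow> (('a \<Rightarrow> real) \<Rightarrow> real) \<Rightarrow> (real \<Rightarrow> ennreal) \<Rightarrow>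
   ('a \<Rightarrow> real) set" where
  "orlicz_space M E N \<phi> = {x \<in> L0 M. \<exists>r>0. modular M E N \<phi> (\<lambda>t. r * x t) < \<infinity>}"

text \<open>
  If \<open>alpha_E M E \<phi> > 0\<close>, the set below is nonempty for every \<open>x\<close> in the Orlicz space, so
  that the infimum is the infimum in \<open>[0,\<infinity>)\<close>.
\<close>

definition orlicz_norm ::
  "'a measure \<Rightarrow> ('a \<Rightarrow> real) set \<Rightarrow> (('a \<Rightarrow> real) \<Rightarrow> real) \<Rightarrow> (real \<Rightarrow> ennreal) \<Rightarrow>
   ('a \<Rightarrow> real) \<Rightarrow> real" where
  "orlicz_norm M E N \<phi> x = Inf {r. r > 0 \<and> modular M E N \<phi> (\<lambda>t. x t / r) \<le> 1}"

definition linfty :: "(nat \<Rightarrow> real) set" where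
  "linfty = {z. bounded (range z)}"

definition linfty_norm :: "(nat \<Rightarrow> real) \<Rightarrow> real" where
  "linfty_norm z = (SUP n. \<bar>z n\<bar>)"

definition contains_order_isometric_linfty ::
  "'a measure \<Rightarrow> ('a \<Rightarrow> real) set \<Rightarrow> (('a \<Rightarrow> real) \<Rightarrow> real) \<Rightarrow> bool" where
  "contains_order_isometric_linfty M F NF \<longleftrightarrow>
     (\<exists>P :: (nat \<Rightarrow> real) \<Rightarrow> 'a \<Rightarrow> real.
        (\<forall>z\<in>linfty. P z \<in> F) \<and>
        (\<forall>z\<in>linfty. \<forall>w\<in>linfty. AE t in M. P (\<lambda>n. z n + w n) t = P z t + P w t) \<and>
        (\<forall>c. \<forall>z\<in>linfty. AE t in M. P (\<lambda>n. c * z n) t = c * P z t) \<and>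
        (\<forall>z\<in>linfty. NF (P z) = linfty_norm z) \<and>
        (\<forall>z\<in>linfty. AE t in M. \<bar>P z t\<bar> = P (\<lambda>n. \<bar>z n\<bar>) t))"

end

theory Submission
  imports Defs
begin

text \<open>
  It suffices to find disjoint sets \<open>B m\<close> and numbers \<open>u m > 0\<close> such that the function
  \<open>x\<close> equal to \<open>u m\<close> on \<open>B m\<close> has modular at most \<open>1\<close>, whereas dilating it by
  \<open>1 + 1 / Suc m\<close> makes the modular exceed \<open>1\<close> already on the single set \<open>B m\<close>. Distribute
  the sets over infinitely many groups, each of them infinite, and let \<open>P z\<close> be \<open>z n * x\<close> on the
  \<open>n\<close>-th group. If \<open>\<bar>z n\<bar> \<le> r\<close> for all \<open>n\<close>, then \<open>P z / r\<close> is dominated by \<open>x\<close> and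
  has modular at most \<open>1\<close>; if \<open>\<bar>z n\<bar> > r\<close> for some \<open>n\<close>, then \<open>P z / r\<close> exceeds a
  dilation of \<open>x\<close> by a factor above \<open>1\<close> on a group in which those factors \<open>1 + 1 / Suc m\<close>
  come arbitrarily close to \<open>1\<close>. So \<open>P z\<close> has norm \<open>sup \<bar>z n\<bar>\<close>
  (\<open>contains_linfty_if_step_functions\<close>).

  The numbers come from the failure of \<open>\<Delta>\<^sub>2(0)\<close>: for no \<open>l > 1\<close> is \<open>\<phi> (l * u)\<close>
  bounded by a constant multiple of \<open>\<phi> u\<close>, because such a bound could be iterated to
  cover the factor \<open>2\<close>. Hence there are a level \<open>u\<close> and a size \<open>s\<close> with
  \<open>\<phi> u * s\<close> small and \<open>\<phi> (l * u) * s\<close> large (\<open>orlicz_scaled_jump\<close>). This covers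
  both the case in which \<open>\<phi>\<close> vanishes near \<open>0\<close>, where \<open>\<phi> u = 0\<close> is possible, and the case
  in which \<open>\<phi>\<close> jumps to \<open>\<infinity>\<close>.

  It remains to realise prescribed sizes \<open>s\<close> as quasi-norms of indicator functions of
  disjoint sets, at least up to the constant \<open>C\<close> of the quasi-triangle inequality
  (\<open>exists_set_of_norm\<close>). A set \<open>D\<close> disjoint from the earlier ones and maximal subject to
  \<open>N (indicator D) \<le> s\<close> exists by the Fatou property. As \<open>L\<^sub>\<infinity>\<close> is not contained in \<open>E\<close>, the
  union of \<open>D\<close> and the earlier sets, whose indicator lies in \<open>E\<close>, leaves a remainder of
  positive measure. Since \<open>E\<^sub>a\<close> has full support and \<open>M\<close> is
  nonatomic, the remainder contains sets of positive measure and arbitrarily small norm, and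
  adding one of them to \<open>D\<close> leads beyond \<open>s\<close>; thus \<open>N (indicator D)\<close> is at least \<open>s / C\<close>.
\<close>

section \<open>Exhaustion and nonatomic measures\<close>

lemma (in sigma_finite_measure) equivalent_finite_measure:
  obtains \<nu> where "finite_measure \<nu>" "sets \<nu> = sets M" "null_sets \<nu> = null_sets M"
proof -
  obtain f :: "'a \<Rightarrow> real" where f: "f \<in> borel_measurable M" "\<And>x. f x > 0" "integrable M f"
    using obtain_positive_integrable_function by metis
  define \<nu> where "\<nu> = density M (\<lambda>x. ennreal (f x))"
  show thesis
  proof
    have "emeasure \<nu> (space \<nu>) = (\<integral>\<^sup>+ x. ennreal (f x) \<partial>M)"
      using f(1) by (simp add: \<nu>_def emeasure_density cong: nn_integral_cong)
    also have "\<dots> = ennreal (integral\<^sup>L M f)"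
      using f by (intro nn_integral_eq_integral) (auto intro: less_imp_le)
    finally show "finite_measure \<nu>" by (intro finite_measureI) simp
    show "sets \<nu> = sets M" by (simp add: \<nu>_def)
    show "null_sets \<nu> = null_sets M"
    proof (intro set_eqI)
      fix A
      have "A \<in> null_sets \<nu> \<longleftrightarrow> A \<in> sets M \<and> (AE x in M. x \<notin> A)"
        using f(1) f(2)[THEN not_le[THEN iffD2]]
        by (simp add: \<nu>_def null_sets_density_iff ennreal_eq_0_iff)
      also have "\<dots> \<longleftrightarrow> A \<in> null_sets M" by (metis AE_iff_null_sets null_setsD2)
      finally show "A \<in> null_sets \<nu> \<longleftrightarrow> A \<in> null_sets M" .
    qed
  qed
qed

text \<open>
  Greedy exhaustion: each step realises, up to \<open>1 / Suc n\<close>, the largest measure that is still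
  attainable, so that nothing of positive measure can be added to the union of the steps.
\<close>

lemma (in sigma_finite_measure) exists_ae_maximal_set:
  assumes D0: "D0 \<in> \<D>" and sets: "\<D> \<subseteq> sets M"
    and closed: "\<And>D :: nat \<Rightarrow> 'a set. \<lbrakk>incseq D; \<And>n. D n \<in> \<D>\<rbrakk> \<Longrightarrow> (\<Union>n. D n) \<in> \<D>"
  obtains D where "D \<in> \<D>" "\<And>D'. \<lbrakk>D' \<in> \<D>; D \<subseteq> D'\<rbrakk> \<Longrightarrow> D' - D \<in> null_sets M"
proof -
  obtain \<nu> where \<nu>: "finite_measure \<nu>" "sets \<nu> = sets M" "null_sets \<nu> = null_sets M"
    by (rule equivalent_finite_measure)
  interpret \<nu>: finite_measure \<nu> by fact
  have "\<exists>D. \<forall>n. D n \<in> \<D> \<and> (D n \<subseteq> D (Suc n) \<and>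
      (\<forall>D'\<in>\<D>. D n \<subseteq> D' \<longrightarrow> measure \<nu> D' \<le> measure \<nu> (D (Suc n)) + 1 / Suc n))"
  proof (rule dependent_nat_choice)
    show "\<exists>D. D \<in> \<D>" using D0 by blast
  next
    fix D n assume D: "D \<in> \<D>"
    define S where "S = measure \<nu> ` {D' \<in> \<D>. D \<subseteq> D'}"
    have bdd: "bdd_above S" unfolding S_def
      by (intro bdd_aboveI[where M = "measure \<nu> (space \<nu>)"]) (auto intro: \<nu>.bounded_measure)
    have "S \<noteq> {}" using D by (auto simp: S_def)
    moreover have "Sup S - 1 / Suc n < Sup S" by simp
    ultimately obtain r where "r \<in> S" "Sup S - 1 / Suc n < r"
      using less_cSup_iff[OF _ bdd] by blast
    then obtain D1 where "D1 \<in> \<D>" "D \<subseteq> D1" "Sup S - 1 / Suc n < measure \<nu> D1"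
      by (auto simp: S_def)
    moreover have "measure \<nu> D' \<le> measure \<nu> D1 + 1 / Suc n" if "D' \<in> \<D>" "D \<subseteq> D'" for D'
    proof -
      have "measure \<nu> D' \<le> Sup S" using that by (intro cSup_upper bdd) (auto simp: S_def)
      with \<open>Sup S - 1 / Suc n < measure \<nu> D1\<close> show ?thesis by linarith
    qed
    ultimately show "\<exists>D1. D1 \<in> \<D> \<and> (D \<subseteq> D1 \<and>
        (\<forall>D'\<in>\<D>. D \<subseteq> D' \<longrightarrow> measure \<nu> D' \<le> measure \<nu> D1 + 1 / Suc n))" by blast
  qed
  then obtain D where D: "\<And>n. D n \<in> \<D>" "\<And>n. D n \<subseteq> D (Suc n)"
    and big: "\<And>n D'. \<lbrakk>D' \<in> \<D>; D n \<subseteq> D'\<rbrakk> \<Longrightarrow> measure \<nu> D' \<le> measure \<nu> (D (Suc n)) + 1 / Suc n"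
    by blast
  define U where "U = (\<Union>n. D n)"
  have U: "U \<in> \<D>" unfolding U_def using D by (intro closed incseq_SucI) auto
  show thesis
  proof
    show "U \<in> \<D>" by fact
    fix D' assume D': "D' \<in> \<D>" "U \<subseteq> D'"
    have UD [measurable]: "U \<in> sets \<nu>" "D' \<in> sets \<nu>" using sets U D' \<nu>(2) by auto
    have "measure \<nu> D' \<le> measure \<nu> U + 1 / Suc n" for n
    proof -
      have "measure \<nu> D' \<le> measure \<nu> (D (Suc n)) + 1 / Suc n"
        using D' by (intro big) (auto simp: U_def)
      moreover have "measure \<nu> (D (Suc n)) \<le> measure \<nu> U"
        using UD by (intro \<nu>.finite_measure_mono) (auto simp: U_def)
      ultimately show ?thesis by linarith
    qed
    moreover have "(\<lambda>n. measure \<nu> U + 1 / real (Suc n)) \<longlonglongrightarrow> measure \<nu> U + 0"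
      by (intro tendsto_add tendsto_const lim_1_over_n[THEN LIMSEQ_Suc])
    ultimately have "measure \<nu> D' \<le> measure \<nu> U"
      by (intro LIMSEQ_le_const[of _ "measure \<nu> U"]) auto
    moreover have "measure \<nu> (D' - U) = measure \<nu> D' - measure \<nu> U"
      using UD D' by (intro \<nu>.finite_measure_Diff) auto
    ultimately have "measure \<nu> (D' - U) = 0" by (smt (verit) measure_nonneg)
    then have "D' - U \<in> null_sets \<nu>"
      using UD by (auto simp: null_sets_def \<nu>.emeasure_eq_measure)
    then show "D' - U \<in> null_sets M" by (simp add: \<nu>(3))
  qed
qed

text \<open>
  Of the two parts of a splitting, the one that is smaller for an equivalent finite measure has at
  most half the measure; iterating drives the measure to \<open>0\<close>.
\<close>

lemma (in sigma_finite_measure) nonatomic_shrinking_sets: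
  assumes "nonatomic M" and A: "A \<in> sets M" "A \<notin> null_sets M"
  obtains B where "\<And>n::nat. B n \<in> sets M" "\<And>n. B n \<notin> null_sets M" "\<And>n. B n \<subseteq> A"
    "AE t in M. (\<lambda>n. indicat_real (B n) t) \<longlonglongrightarrow> 0"
proof -
  obtain \<nu> where \<nu>: "finite_measure \<nu>" "sets \<nu> = sets M" "null_sets \<nu> = null_sets M"
    by (rule equivalent_finite_measure)
  interpret \<nu>: finite_measure \<nu> by fact
  have half: "\<exists>C. (C \<in> sets M \<and> C \<notin> null_sets M \<and> C \<subseteq> A) \<and>
      C \<subseteq> B \<and> measure \<nu> C \<le> measure \<nu> B / 2"
    if B: "B \<in> sets M \<and> B \<notin> null_sets M \<and> B \<subseteq> A" for B
  proof -
    have "emeasure M B > 0" using B by (auto simp: null_sets_def zero_less_iff_neq_zero)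
    then obtain C where C: "C \<in> sets M" "C \<subseteq> B" "emeasure M C > 0" "emeasure M (B - C) > 0"
      using assms(1) B unfolding nonatomic_def by blast
    have "measure \<nu> (B - C) = measure \<nu> B - measure \<nu> C"
      using B C \<nu>(2) by (intro \<nu>.finite_measure_Diff) auto
    then consider "measure \<nu> C \<le> measure \<nu> B / 2" | "measure \<nu> (B - C) \<le> measure \<nu> B / 2"
      by linarith
    then show ?thesis
    proof cases
      case 1
      then show ?thesis using B C by (intro exI[of _ C]) (auto simp: null_sets_def)
    next
      case 2
      then show ?thesis using B C by (intro exI[of _ "B - C"]) (auto simp: null_sets_def)
    qed
  qed
  have "\<exists>B. \<forall>n::nat. (B n \<in> sets M \<and> B n \<notin> null_sets M \<and> B n \<subseteq> A) \<and>
      B (Suc n) \<subseteq> B n \<and> measure \<nu> (B (Suc n)) \<le> measure \<nu> (B n) / 2"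
    by (rule dependent_nat_choice) (use A half in blast)+
  then obtain B where B: "\<And>n::nat. B n \<in> sets M" "\<And>n. B n \<notin> null_sets M" "\<And>n. B n \<subseteq> A"
    and dec: "\<And>n. B (Suc n) \<subseteq> B n" and le: "\<And>n. measure \<nu> (B (Suc n)) \<le> measure \<nu> (B n) / 2"
    by blast
  have geo: "measure \<nu> (B n) \<le> measure \<nu> (B 0) * (1 / 2) ^ n" for n
  proof (induction n)
    case (Suc n)
    then show ?case using le[of n] by simp
  qed simp
  define Z where "Z = (\<Inter>n. B n)"
  have Z: "Z \<in> sets \<nu>" using B(1) by (auto simp: Z_def \<nu>(2))
  have "measure \<nu> Z \<le> measure \<nu> (B 0) * (1 / 2) ^ n" for n
  proof -
    have "measure \<nu> Z \<le> measure \<nu> (B n)"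
      using B(1) by (intro \<nu>.finite_measure_mono) (auto simp: Z_def \<nu>(2))
    then show ?thesis using geo[of n] by linarith
  qed
  moreover have "(\<lambda>n. measure \<nu> (B 0) * (1 / 2 :: real) ^ n) \<longlonglongrightarrow> measure \<nu> (B 0) * 0"
    by (intro tendsto_mult tendsto_const LIMSEQ_power_zero) auto
  ultimately have "measure \<nu> Z \<le> 0"
    by (intro LIMSEQ_le_const[of _ 0]) auto
  then have "measure \<nu> Z = 0" by (smt (verit) measure_nonneg)
  then have "Z \<in> null_sets M"
    using Z \<nu>(3) by (auto simp: null_sets_def \<nu>.emeasure_eq_measure)
  then have "AE t in M. t \<notin> Z" by (rule AE_not_in)
  then have "AE t in M. (\<lambda>n. indicat_real (B n) t) \<longlonglongrightarrow> 0"
  proof eventually_elim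
    case (elim t)
    then obtain n0 where n0: "t \<notin> B n0" by (auto simp: Z_def)
    have "t \<notin> B n" if "n0 \<le> n" for n
      using lift_Suc_antimono_le[of B, OF dec that] n0 by blast
    then have "\<forall>\<^sub>F n in sequentially. indicat_real (B n) t = 0"
      by (auto simp: eventually_sequentially intro!: exI[of _ n0])
    then show ?case by (rule tendsto_eventually)
  qed
  with B show thesis by (rule that)
qed


section \<open>Sets with prescribed norm of the indicator function\<close>

lemma AE_indicator_eq_if_null_diff:
  assumes "A - B \<in> null_sets M" "B \<subseteq> A"
  shows "AE t in M. indicat_real A t = indicat_real B t"
  using AE_not_in[OF assms(1)] by eventually_elim (use assms(2) in \<open>auto simp: indicator_def\<close>)

context quasi_banach_ideal_space
begin

lemma norm_zero: "N (\<lambda>t. 0) = 0"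
  using norm_eq_0_iff[OF zero_mem] by simp

lemma indicator_union_mem:
  assumes "A \<in> sets M" "B \<in> sets M" "indicat_real A \<in> E" "indicat_real B \<in> E"
  shows "indicat_real (A \<union> B) \<in> E"
proof -
  have "indicat_real (A \<union> B) \<in> E \<and> N (indicat_real (A \<union> B)) \<le>
      N (\<lambda>t. indicat_real A t + indicat_real B t)"
    using assms by (intro ideal add_mem) (auto split: split_indicator)
  then show ?thesis ..
qed

lemma Linf_subset_if_one_mem:
  assumes "indicat_real (space M) \<in> E"
  shows "Linf M \<subseteq> E"
proof
  fix x assume "x \<in> Linf M"
  then obtain c where x: "x \<in> L0 M" and c: "AE t in M. \<bar>x t\<bar> \<le> c" by (auto simp: Linf_def)
  have "AE t in M. \<bar>x t\<bar> \<le> \<bar>c * indicat_real (space M) t\<bar>"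
    using c AE_space by eventually_elim auto
  with ideal[OF x scale_mem[OF assms]] show "x \<in> E" by blast
qed

lemma order_continuous_indicator_tendsto:
  assumes y: "y \<in> order_continuous_part M E N"
    and B: "\<And>n::nat. B n \<in> sets M" "AE t in M. (\<lambda>n. indicat_real (B n) t) \<longlonglongrightarrow> 0"
    and c: "c > 0" "\<And>n t. t \<in> B n \<Longrightarrow> c \<le> \<bar>y t\<bar>"
  shows "\<And>n. indicat_real (B n) \<in> E" "(\<lambda>n. N (indicat_real (B n))) \<longlonglongrightarrow> 0"
proof -
  let ?x = "\<lambda>n t. c * indicat_real (B n) t"
  have le: "0 \<le> ?x n t \<and> ?x n t \<le> \<bar>y t\<bar>" for n t
    using c by (auto simp: indicator_def)
  have meas: "?x n \<in> L0 M" for n using B(1) by measurable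
  have yE: "y \<in> E" using y by (simp add: order_continuous_part_def)
  have xE: "?x n \<in> E" for n
    using le by (intro conjunct1[OF ideal[OF meas yE]]) auto
  have eq: "(\<lambda>t. inverse c * ?x n t) = indicat_real (B n)" for n
    using c(1) by (auto simp: fun_eq_iff)
  show mem: "indicat_real (B n) \<in> E" for n
    using scale_mem[OF xE, of "inverse c" n] unfolding eq .
  have "AE t in M. (\<lambda>n. ?x n t) \<longlonglongrightarrow> 0"
    using B(2) by eventually_elim (auto intro: tendsto_mult_right_zero)
  then have "(\<lambda>n. N (?x n)) \<longlonglongrightarrow> 0"
    using y meas le unfolding order_continuous_part_def by simp
  then have "(\<lambda>n. inverse c * N (?x n)) \<longlonglongrightarrow> 0" by (rule tendsto_mult_right_zero)
  moreover have "inverse c * N (?x n) = N (indicat_real (B n))" for n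
    using norm_scale[OF xE, of "inverse c" n] c(1) unfolding eq by simp
  ultimately show "(\<lambda>n. N (indicat_real (B n))) \<longlonglongrightarrow> 0" by simp
qed

lemma fatou_propertyD:
  assumes "fatou_property M E N" "\<And>n. xs n \<in> E" "x \<in> L0 M"
    and "\<And>n t. 0 \<le> xs n t" "\<And>t. incseq (\<lambda>n. xs n t)" "\<And>t. (\<lambda>n. xs n t) \<longlonglongrightarrow> \<bar>x t\<bar>"
    and le: "\<And>n. N (xs n) \<le> c"
  shows "x \<in> E \<and> N x \<le> c"
proof -
  have "(\<forall>n. xs n \<in> E) \<and> x \<in> L0 M \<and>
      (AE t in M. (\<forall>n. 0 \<le> xs n t) \<and> incseq (\<lambda>n. xs n t) \<and> (\<lambda>n. xs n t) \<longlonglongrightarrow> \<bar>x t\<bar>) \<and>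
      bdd_above (range (\<lambda>n. N (xs n)))"
    using assms by (intro conjI allI AE_I2 bdd_aboveI[where M = c]) auto
  then have "x \<in> E \<and> (\<lambda>n. N (xs n)) \<longlonglongrightarrow> N x"
    using assms(1) unfolding fatou_property_def by blast
  moreover from this have "N x \<le> c" using le by (intro LIMSEQ_le_const2) auto
  ultimately show ?thesis by blast
qed

text \<open>
  The complement of \<open>G\<close> is not null, as otherwise \<open>indicator G\<close> would be the constant \<open>1\<close>
  almost everywhere and \<open>E\<close> would contain \<open>L\<^sub>\<infinity>\<close>. By the full support, some order continuous element is bounded
  away from \<open>0\<close> on a non-null set outside \<open>G\<close>, and that set can be shrunk to a null set.
\<close>

lemma exists_small_set_outside:
  assumes "sigma_finite_measure M" "nonatomic M" "\<not> Linf M \<subseteq> E"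
    and supp: "is_support M (order_continuous_part M E N) (space M)"
    and G: "G \<in> sets M" "indicat_real G \<in> E" and "\<delta> > 0"
  obtains B where "B \<in> sets M" "B \<notin> null_sets M" "B \<inter> G = {}"
    "indicat_real B \<in> E" "N (indicat_real B) < \<delta>"
proof -
  interpret sigma_finite_measure M by fact
  have "space M - G \<notin> null_sets M"
  proof
    assume "space M - G \<in> null_sets M"
    then have "AE t in M. indicat_real (space M) t = indicat_real G t"
      using G sets.sets_into_space by (intro AE_indicator_eq_if_null_diff) auto
    then have "indicat_real (space M) \<in> E"
      by (intro conjunct1[OF ideal[OF _ G(2)]]) auto
    then show False using Linf_subset_if_one_mem assms(3) by blast
  qed
  then obtain y where y: "y \<in> order_continuous_part M E N"
    and nz: "\<not> (AE t in M. t \<notin> G \<longrightarrow> y t = 0)"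
    using supp G(1) unfolding is_support_def by blast
  have ym [measurable]: "y \<in> L0 M"
    using y subset_L0 by (auto simp: order_continuous_part_def)
  note [measurable] = G(1)
  define A where "A k = {t \<in> space M. t \<notin> G \<and> 1 / Suc k \<le> \<bar>y t\<bar>}" for k :: nat
  have A: "A k \<in> sets M" for k unfolding A_def by measurable
  have "\<exists>k. A k \<notin> null_sets M"
  proof (rule ccontr)
    assume "\<nexists>k. A k \<notin> null_sets M"
    then have "(\<Union>k. A k) \<in> null_sets M" by (intro null_sets_UN) auto
    then have "AE t in M. t \<notin> (\<Union>k. A k)" by (rule AE_not_in)
    then have "AE t in M. t \<notin> G \<longrightarrow> y t = 0" using AE_space
    proof eventually_elim
      case (elim t)
      show ?case
      proof (intro impI, rule ccontr)
        assume t: "t \<notin> G" "y t \<noteq> 0"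
        then obtain k where "inverse (real (Suc k)) < \<bar>y t\<bar>"
          using reals_Archimedean[of "\<bar>y t\<bar>"] by auto
        then have "1 / real (Suc k) \<le> \<bar>y t\<bar>" by (simp only: inverse_eq_divide)
        then have "t \<in> A k" using elim t by (simp add: A_def)
        then show False using elim by blast
      qed
    qed
    then show False using nz by blast
  qed
  then obtain k where k: "A k \<notin> null_sets M" by blast
  obtain B where B: "\<And>n::nat. B n \<in> sets M" "\<And>n. B n \<notin> null_sets M" "\<And>n. B n \<subseteq> A k"
    and lim: "AE t in M. (\<lambda>n. indicat_real (B n) t) \<longlonglongrightarrow> 0"
    using nonatomic_shrinking_sets[OF assms(2) A k] by metis
  have c: "1 / real (Suc k) > 0" "\<And>n t. t \<in> B n \<Longrightarrow> 1 / real (Suc k) \<le> \<bar>y t\<bar>"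
    using B(3) by (auto simp: A_def)
  have small: "indicat_real (B n) \<in> E" "(\<lambda>n. N (indicat_real (B n))) \<longlonglongrightarrow> 0" for n
    by (rule order_continuous_indicator_tendsto[OF y B(1) lim c]; assumption)+
  from small(2) obtain n where "N (indicat_real (B n)) < \<delta>"
    using order_tendstoD(2)[OF small(2) assms(7)] eventually_happens'[OF sequentially_bot] by blast
  with B(1,2) small(1) show thesis
    by (intro that[of "B n"]) (use B(3)[of n] in \<open>auto simp: A_def\<close>)
qed

text \<open>
  Take \<open>D\<close> maximal, up to null sets, among the sets outside \<open>F\<close> whose indicator has quasi-norm at
  most \<open>s\<close>; the Fatou property makes this family closed under increasing unions. Adding a set of
  small norm to \<open>D\<close> exceeds \<open>s\<close>, which by the quasi-triangle inequality bounds the norm of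
  \<open>D\<close> from below.
\<close>

lemma exists_set_of_norm:
  assumes "sigma_finite_measure M" "nonatomic M" "\<not> Linf M \<subseteq> E" and fatou: "fatou_property M E N"
    and supp: "is_support M (order_continuous_part M E N) (space M)"
    and C: "C \<ge> 1" "\<And>x y. \<lbrakk>x \<in> E; y \<in> E\<rbrakk> \<Longrightarrow> N (\<lambda>t. x t + y t) \<le> C * (N x + N y)"
    and F: "F \<in> sets M" "indicat_real F \<in> E" and "s > 0"
  obtains D where "D \<in> sets M" "D \<inter> F = {}" "indicat_real D \<in> E"
    "s / C \<le> N (indicat_real D)" "N (indicat_real D) \<le> s"
proof -
  interpret sigma_finite_measure M by fact
  define \<D> where
    "\<D> = {D \<in> sets M. D \<inter> F = {} \<and> indicat_real D \<in> E \<and> N (indicat_real D) \<le> s}"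
  have empty: "{} \<in> \<D>"
    using zero_mem norm_zero assms(10) by (simp add: \<D>_def indicator_def[abs_def])
  have closed: "(\<Union>n. D n) \<in> \<D>" if inc: "incseq D" and D: "\<And>n. D n \<in> \<D>"
    for D :: "nat \<Rightarrow> 'a set"
  proof -
    let ?U = "\<Union>n. D n"
    have U: "?U \<in> sets M" using D by (auto simp: \<D>_def)
    have "indicat_real ?U \<in> E \<and> N (indicat_real ?U) \<le> s"
    proof (rule fatou_propertyD[OF fatou, where xs = "\<lambda>n. indicat_real (D n)"])
      show "incseq (\<lambda>n. indicat_real (D n) t)" for t
        using inc by (auto simp: incseq_def indicator_def)
      show "(\<lambda>n. indicat_real (D n) t) \<longlonglongrightarrow> \<bar>indicat_real ?U t\<bar>" for t
        using LIMSEQ_indicator_incseq[OF inc] by simp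
    qed (use D U in \<open>auto simp: \<D>_def\<close>)
    with D U show ?thesis by (auto simp: \<D>_def)
  qed
  obtain D where D: "D \<in> \<D>"
    and max: "\<And>D'. \<lbrakk>D' \<in> \<D>; D \<subseteq> D'\<rbrakk> \<Longrightarrow> D' - D \<in> null_sets M"
    using exists_ae_maximal_set[OF empty _ closed] by (auto simp: \<D>_def)
  have DE: "D \<in> sets M" "D \<inter> F = {}" "indicat_real D \<in> E" "N (indicat_real D) \<le> s"
    using D by (auto simp: \<D>_def)
  have "s / C \<le> N (indicat_real D) + \<delta>" if \<delta>: "\<delta> > 0" for \<delta>
  proof -
    have "indicat_real (F \<union> D) \<in> E" using DE F by (intro indicator_union_mem)
    then obtain B where B: "B \<in> sets M" "B \<notin> null_sets M" "B \<inter> (F \<union> D) = {}"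
      "indicat_real B \<in> E" "N (indicat_real B) < \<delta>"
      using exists_small_set_outside[OF assms(1,2,3) supp, of "F \<union> D" \<delta>] F DE \<delta> by blast
    have "D \<union> B \<notin> \<D>"
    proof
      assume "D \<union> B \<in> \<D>"
      then have "D \<union> B - D \<in> null_sets M" by (rule max) auto
      moreover have "D \<union> B - D = B" using B(3) by auto
      ultimately show False using B(2) by simp
    qed
    then have "s < N (indicat_real (D \<union> B))"
      using B DE indicator_union_mem[of D B] by (auto simp: \<D>_def)
    also have "indicat_real (D \<union> B) = (\<lambda>t. indicat_real D t + indicat_real B t)"
      using B(3) by (auto simp: fun_eq_iff indicator_def)
    also have "N \<dots> \<le> C * (N (indicat_real D) + N (indicat_real B))"
      using DE B by (intro C(2))
    also have "\<dots> \<le> C * (N (indicat_real D) + \<delta>)"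
      using B(5) C(1) by (intro mult_left_mono) auto
    finally show ?thesis using C(1) by (simp add: field_simps)
  qed
  then have "s / C \<le> N (indicat_real D)" by (rule field_le_epsilon)
  with DE show thesis by (intro that)
qed

end


section \<open>Functions that are constant on the members of a disjoint sequence of sets\<close>

text \<open>
  The least index of a set containing \<open>t\<close> is measurable in \<open>t\<close>, so that a step function is
  measurable for an arbitrary sequence of values.
\<close>

definition step_function :: "(nat \<Rightarrow> 'a set) \<Rightarrow> (nat \<Rightarrow> real) \<Rightarrow> 'a \<Rightarrow> real" where
  "step_function B w t = (if t \<in> (\<Union>m. B m) then w (LEAST m. t \<in> B m) else 0)"

lemma step_function_eq:
  assumes "disjoint_family B" "t \<in> B m"
  shows "step_function B w t = w m"
proof -
  have "t \<in> B n \<longleftrightarrow> n = m" for n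
    using assms disjoint_family_onD[OF assms(1), of n m] by auto
  then have "(LEAST n. t \<in> B n) = m" by (intro Least_equality) auto
  then show ?thesis using assms(2) by (auto simp: step_function_def)
qed

lemma step_function_outside: "t \<notin> (\<Union>m. B m) \<Longrightarrow> step_function B w t = 0"
  by (auto simp: step_function_def)

lemma step_function_measurable:
  assumes "\<And>m. B m \<in> sets M"
  shows "step_function B w \<in> borel_measurable M"
proof -
  note [measurable] = assms
  have "(\<lambda>t. LEAST m. t \<in> B m) \<in> measurable M (count_space UNIV)" by measurable
  then have [measurable]: "(\<lambda>t. w (LEAST m. t \<in> B m)) \<in> borel_measurable M"
    by (rule measurable_compose) simp
  show ?thesis unfolding step_function_def[abs_def] by measurable
qed

text \<open>
  Backward induction on \<open>k\<close>: splitting off the \<open>k\<close>-th summand costs one factor \<open>C\<close>, and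
  \<open>C * (q ^ Suc k + q ^ Suc k) = q ^ k\<close> for \<open>q = 1 / (2 * C)\<close>.
\<close>

lemma (in quasi_banach_ideal_space) sum_indicators_norm_le:
  assumes C: "C \<ge> 1" "\<And>x y. \<lbrakk>x \<in> E; y \<in> E\<rbrakk> \<Longrightarrow> N (\<lambda>t. x t + y t) \<le> C * (N x + N y)"
    and B: "\<And>m. indicat_real (B m) \<in> E"
    and v: "\<And>m. 0 \<le> v m" "\<And>m. v m * N (indicat_real (B m)) \<le> (1 / (2 * C)) ^ Suc m"
  shows "(\<lambda>t. \<Sum>m=k..<n. v m * indicat_real (B m) t) \<in> E \<and>
    N (\<lambda>t. \<Sum>m=k..<n. v m * indicat_real (B m) t) \<le> (1 / (2 * C)) ^ k"
proof (induction "n - k" arbitrary: k)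
  case 0
  then show ?case using zero_mem norm_zero C(1) by simp
next
  case (Suc d)
  let ?y = "\<lambda>k t. \<Sum>m=k..<n. v m * indicat_real (B m) t"
  let ?q = "1 / (2 * C)"
  have IH: "?y (Suc k) \<in> E" "N (?y (Suc k)) \<le> ?q ^ Suc k"
    using Suc(1)[of "Suc k"] Suc(2) by auto
  have eq: "?y k = (\<lambda>t. v k * indicat_real (B k) t + ?y (Suc k) t)"
    using Suc(2) by (simp add: fun_eq_iff sum.atLeast_Suc_lessThan del: sum_mult_indicator)
  have k: "(\<lambda>t. v k * indicat_real (B k) t) \<in> E" using B by (rule scale_mem)
  have "N (?y k) \<le> C * (N (\<lambda>t. v k * indicat_real (B k) t) + N (?y (Suc k)))"
    unfolding eq using k IH by (intro C(2))
  also have "\<dots> \<le> C * (?q ^ Suc k + ?q ^ Suc k)"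
  proof (intro mult_left_mono add_mono)
    show "N (\<lambda>t. v k * indicat_real (B k) t) \<le> ?q ^ Suc k"
      using norm_scale[OF B] v by simp
  qed (use IH C(1) in auto)
  also have "\<dots> = ?q ^ k" using C(1) by (simp add: mult.assoc[symmetric])
  finally have "N (?y k) \<le> ?q ^ k" .
  moreover have "?y k \<in> E" unfolding eq using k IH(1) by (rule add_mem)
  ultimately show ?case by blast
qed

text \<open>
  The partial sums are bounded by \<open>1\<close>, and the Fatou property passes from them to the
  whole function.
\<close>

lemma (in quasi_banach_ideal_space) step_function_mem:
  assumes fatou: "fatou_property M E N"
    and C: "C \<ge> 1" "\<And>x y. \<lbrakk>x \<in> E; y \<in> E\<rbrakk> \<Longrightarrow> N (\<lambda>t. x t + y t) \<le> C * (N x + N y)"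
    and B: "disjoint_family B" "\<And>m. B m \<in> sets M" "\<And>m. indicat_real (B m) \<in> E"
    and v: "\<And>m. 0 \<le> v m" "\<And>m. v m * N (indicat_real (B m)) \<le> (1 / (2 * C)) ^ Suc m"
  shows "step_function B v \<in> E \<and> N (step_function B v) \<le> 1"
proof -
  let ?y = "\<lambda>n t. \<Sum>m=0..<n. v m * indicat_real (B m) t"
  have "?y n \<in> E \<and> N (?y n) \<le> (1 / (2 * C)) ^ 0" for n
    by (rule sum_indicators_norm_le) (fact C B(3) v)+
  then have y: "?y n \<in> E \<and> N (?y n) \<le> 1" for n by (simp only: power_0)
  have step: "0 \<le> v m * indicat_real (B m) t" for m t using v(1) by simp
  have lim: "(\<lambda>n. ?y n t) \<longlonglongrightarrow> \<bar>step_function B v t\<bar>" for t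
  proof (cases "t \<in> (\<Union>m. B m)")
    case True
    then obtain j where j: "t \<in> B j" by blast
    have "v m * indicat_real (B m) t = (if m = j then v j else 0)" for m
      using j disjoint_family_onD[OF B(1), of m j] by (auto simp: indicator_def)
    then have "?y n t = (\<Sum>m=0..<n. if m = j then v j else 0)" for n by presburger
    then have "?y n t = v j" if "n \<ge> Suc j" for n
      using that by (simp del: sum_mult_indicator)
    then have "\<forall>\<^sub>F n in sequentially. ?y n t = v j"
      unfolding eventually_sequentially by blast
    moreover have "\<bar>step_function B v t\<bar> = v j"
      using step_function_eq[OF B(1) j, of v] v(1)[of j] by simp
    ultimately show ?thesis using tendsto_eventually by metis
  next
    case False
    then have "?y n t = 0" for n by (intro sum.neutral) auto
    with step_function_outside[OF False, of v] show ?thesis by (simp only: abs_zero tendsto_const)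
  qed
  show "step_function B v \<in> E \<and> N (step_function B v) \<le> 1"
  proof (rule fatou_propertyD[OF fatou, where xs = ?y])
    show "0 \<le> ?y n t" for n t by (intro sum_nonneg step)
    show "incseq (\<lambda>n. ?y n t)" for t
      by (intro incseq_SucI) (simp only: sum.atLeast0_lessThan_Suc le_add_same_cancel1 step)
    show "step_function B v \<in> L0 M" using B(2) by (rule step_function_measurable)
  qed (use y lim in blast)+
qed


section \<open>Dilation growth of Orlicz functions outside \<open>\<Delta>\<^sub>2(0)\<close>\<close>

lemma orlicz_mono:
  assumes "orlicz_function \<phi>" "0 \<le> u" "u \<le> v"
  shows "\<phi> u \<le> \<phi> v"
  using assms unfolding orlicz_function_def by (auto elim!: mono_onD)

lemma orlicz_zero: "orlicz_function \<phi> \<Longrightarrow> \<phi> 0 = 0"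
  by (simp add: orlicz_function_def)

lemma orlicz_finite_value:
  assumes "orlicz_function \<phi>" "orlicz_a \<phi> < orlicz_b \<phi>"
  obtains u where "u > 0" "\<phi> u < \<infinity>"
proof -
  obtain u where u: "0 \<le> u" "\<phi> u < \<infinity>" "orlicz_a \<phi> < ereal u"
    using assms(2) by (subst (asm) orlicz_b_def) (auto simp: less_SUP_iff)
  have "ereal 0 \<le> orlicz_a \<phi>"
    unfolding orlicz_a_def using assms(1) by (intro SUP_upper) (auto simp: orlicz_function_def)
  then have "ereal 0 < ereal u" using u(3) by (rule le_less_trans)
  then have "0 < u" by simp
  with u(2) show thesis by (intro that)
qed

lemma orlicz_positive_value:
  assumes "orlicz_function \<phi>"
  obtains u where "u > 0" "\<phi> u > 0"
proof -
  have "(\<phi> \<longlongrightarrow> \<infinity>) at_top" using assms by (simp add: orlicz_function_def)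
  then have "\<forall>\<^sub>F u in at_top. \<phi> u > 0" by (rule order_tendstoD) simp
  then have "\<forall>\<^sub>F u in at_top. \<phi> u > 0 \<and> u > 0"
    using eventually_gt_at_top[of 0] by eventually_elim simp
  then obtain u where "\<phi> u > 0 \<and> u > 0"
    using eventually_happens'[OF trivial_limit_at_top_linorder] by blast
  then show thesis by (auto intro: that)
qed

text \<open>
  If \<open>\<phi> (l * u) \<le> K * \<phi> u\<close> held whenever \<open>\<phi> u\<close> is finite, iterating would make \<open>\<phi>\<close> finite
  and positive on the positive half-line and give \<open>\<phi> (2 * u) \<le> K ^ n * \<phi> u\<close> as soon as
  \<open>2 \<le> l ^ n\<close>. So dilations by factors arbitrarily close to \<open>1\<close> behave as badly as doubling.
\<close>

lemma orlicz_dilation_unbounded: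
  assumes \<phi>: "orlicz_function \<phi>" "orlicz_a \<phi> < orlicz_b \<phi>" and "\<not> Delta2_at_0 \<phi>"
    and l: "l > 1" and K: "K > 0"
  obtains u where "u > 0" "\<phi> u < \<infinity>" "ennreal K * \<phi> u < \<phi> (l * u)"
proof (rule ccontr)
  assume "\<not> thesis"
  then have grow: "\<And>u. \<lbrakk>u > 0; \<phi> u < \<infinity>\<rbrakk> \<Longrightarrow> \<phi> (l * u) \<le> ennreal K * \<phi> u"
    using that by (meson not_le)
  have mono: "\<phi> u \<le> \<phi> v" if "0 \<le> u" "u \<le> v" for u v
    using orlicz_mono[OF \<phi>(1)] that by blast
  have iter: "\<phi> (l ^ n * u) \<le> ennreal (K ^ n) * \<phi> u" if u: "u > 0" "\<phi> u < \<infinity>" for n u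
  proof (induction n)
    case (Suc n)
    have "\<phi> (l ^ n * u) < \<infinity>"
      using u(2) by (intro le_less_trans[OF Suc]) (simp add: ennreal_mult_less_top)
    then have "\<phi> (l * (l ^ n * u)) \<le> ennreal K * \<phi> (l ^ n * u)"
      using u l by (intro grow) auto
    also have "\<dots> \<le> ennreal K * (ennreal (K ^ n) * \<phi> u)" by (intro mult_left_mono Suc) auto
    finally show ?case using K by (simp add: ennreal_mult mult.assoc)
  qed simp
  have beyond: "\<exists>n. v \<le> l ^ n * u" if "u > 0" for u v
    using real_arch_pow[OF l, of "v / u"] that by (auto simp: field_simps intro: less_imp_le)
  have fin: "\<phi> v < \<infinity>" if v: "v > 0" for v
  proof -
    obtain u where u: "u > 0" "\<phi> u < \<infinity>" using orlicz_finite_value[OF \<phi>] by blast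
    obtain n where "v \<le> l ^ n * u" using beyond[OF u(1)] by blast
    then have "\<phi> v \<le> ennreal (K ^ n) * \<phi> u"
      using mono[of v "l ^ n * u"] iter[OF u, of n] v by auto
    also have "\<dots> < \<infinity>" using u by (simp add: ennreal_mult_less_top)
    finally show ?thesis .
  qed
  have pos: "\<phi> u > 0" if u: "u > 0" for u
  proof -
    obtain v where v: "v > 0" "\<phi> v > 0" using orlicz_positive_value[OF \<phi>(1)] by blast
    obtain n where "v \<le> l ^ n * u" using beyond[OF u] by blast
    then have "\<phi> v \<le> ennreal (K ^ n) * \<phi> u"
      using mono[of v "l ^ n * u"] iter[OF u fin[OF u], of n] v by auto
    with v(2) show ?thesis by (cases "\<phi> u = 0") (auto simp: zero_less_iff_neq_zero)
  qed
  obtain n where n: "2 \<le> l ^ n" using beyond[of 1 2] by auto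
  have "\<phi> (2 * u) \<le> ennreal (K ^ n) * \<phi> u" if "0 \<le> u" for u
  proof (cases "u = 0")
    case True
    then show ?thesis using orlicz_zero[OF \<phi>(1)] by simp
  next
    case False
    with that have u: "u > 0" by simp
    have "\<phi> (2 * u) \<le> \<phi> (l ^ n * u)" using u n by (intro mono) auto
    also have "\<dots> \<le> ennreal (K ^ n) * \<phi> u" using iter[OF u fin[OF u]] .
    finally show ?thesis .
  qed
  then have "Delta2_at_0 \<phi>"
    unfolding Delta2_at_0_def using K pos[of 1]
    by (intro exI[of _ "K ^ n"] conjI exI[of _ 1]) auto
  with assms(3) show False ..
qed

text \<open>
  If the indicator of a set has quasi-norm \<open>s\<close>, the value \<open>u\<close> on it contributes at most
  \<open>\<epsilon>\<close> to the modular, but its dilation \<open>l * u\<close> contributes at least \<open>R\<close>. If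
  \<open>\<phi> u > 0\<close>, the choice \<open>s = \<epsilon> / \<phi> u\<close> works as soon as \<open>\<phi> (l * u) \<ge> (R / \<epsilon>) * \<phi> u\<close>; if
  \<open>\<phi> u = 0\<close>, any sufficiently large \<open>s\<close> does.
\<close>

lemma orlicz_scaled_jump:
  assumes \<phi>: "orlicz_function \<phi>" "orlicz_a \<phi> < orlicz_b \<phi>" "\<not> Delta2_at_0 \<phi>"
    and l: "l > 1" and \<epsilon>: "\<epsilon> > 0" and R: "R > 0"
  obtains u s where "u > 0" "s > 0" "\<phi> u < \<infinity>" "\<phi> u * ennreal s \<le> ennreal \<epsilon>"
    "ennreal R \<le> \<phi> (l * u) * ennreal s"
proof -
  obtain u where u: "u > 0" "\<phi> u < \<infinity>" "ennreal (R / \<epsilon>) * \<phi> u < \<phi> (l * u)"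
    using orlicz_dilation_unbounded[OF \<phi> l, of "R / \<epsilon>"] \<epsilon> R by auto
  have jump: "\<phi> (l * u) \<noteq> 0" using u(3) by auto
  show thesis
  proof (cases "\<phi> u = 0")
    case zero: True
    show thesis
    proof (cases "\<phi> (l * u) = \<infinity>")
      case True
      show thesis by (rule that[of u 1]) (use u zero True in auto)
    next
      case False
      then obtain r where r: "\<phi> (l * u) = ennreal r" "r > 0"
        using jump by (cases "\<phi> (l * u)") (auto simp: less_le)
      show thesis
        by (rule that[of u "R / r"]) (use u zero r R in \<open>auto simp flip: ennreal_mult\<close>)
    qed
  next
    case False
    then obtain p where p: "\<phi> u = ennreal p" "p > 0"
      using u(2) by (cases "\<phi> u") (auto simp: less_le)
    have "ennreal R = ennreal (R / \<epsilon>) * \<phi> u * ennreal (\<epsilon> / p)"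
      using p \<epsilon> R by (simp flip: ennreal_mult)
    also have "\<dots> \<le> \<phi> (l * u) * ennreal (\<epsilon> / p)" using u(3) by (intro mult_right_mono) auto
    finally have "ennreal R \<le> \<phi> (l * u) * ennreal (\<epsilon> / p)" .
    then show thesis
      by (intro that[of u "\<epsilon> / p"]) (use u p \<epsilon> in \<open>auto simp flip: ennreal_mult\<close>)
  qed
qed

section \<open>The modular of a step function\<close>

context quasi_banach_ideal_space
begin

lemma modular_step_function_le_1:
  assumes \<phi>: "orlicz_function \<phi>" and fatou: "fatou_property M E N"
    and C: "C \<ge> 1" "\<And>x y. \<lbrakk>x \<in> E; y \<in> E\<rbrakk> \<Longrightarrow> N (\<lambda>t. x t + y t) \<le> C * (N x + N y)"
    and B: "disjoint_family B" "\<And>m. B m \<in> sets M" "\<And>m. indicat_real (B m) \<in> E"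
    and fin: "\<And>m. \<phi> (u m) < \<infinity>"
    and small: "\<And>m. enn2real (\<phi> (u m)) * N (indicat_real (B m)) \<le> (1 / (2 * C)) ^ Suc m"
    and w: "\<And>m. \<bar>w m\<bar> \<le> u m"
  shows "modular M E N \<phi> (step_function B w) \<le> 1"
proof -
  let ?v = "\<lambda>m. enn2real (\<phi> \<bar>w m\<bar>)"
  have le: "\<phi> \<bar>w m\<bar> \<le> \<phi> (u m)" for m using orlicz_mono[OF \<phi> _ w] by simp
  have "step_function B ?v \<in> E \<and> N (step_function B ?v) \<le> 1"
  proof (rule step_function_mem)
    fix m
    have "?v m \<le> enn2real (\<phi> (u m))" using le fin by (intro enn2real_mono) auto
    then have "?v m * N (indicat_real (B m)) \<le> enn2real (\<phi> (u m)) * N (indicat_real (B m))"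
      using norm_nonneg[OF B(3)] by (intro mult_right_mono)
    with small[of m] show "?v m * N (indicat_real (B m)) \<le> (1 / (2 * C)) ^ Suc m" by linarith
  qed (fact fatou C B enn2real_nonneg)+
  moreover have "(\<lambda>t. enn2real (\<phi> \<bar>step_function B w t\<bar>)) = step_function B ?v"
    using orlicz_zero[OF \<phi>] by (auto simp: fun_eq_iff step_function_def)
  moreover have "\<phi> \<bar>step_function B w t\<bar> < \<infinity>" for t
    using orlicz_zero[OF \<phi>] le_less_trans[OF le fin] by (simp add: step_function_def)
  ultimately show ?thesis by (simp add: modular_def ennreal_le_1)
qed

text \<open>
  If \<open>\<phi> \<bar>w m\<bar>\<close> is infinite, so is the modular, because \<open>B m\<close> is not null; otherwise the ideal
  property compares the whole function with its restriction to \<open>B m\<close>.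
\<close>

lemma modular_step_function_gt_1:
  assumes \<phi>: "orlicz_function \<phi>"
    and B: "disjoint_family B" "\<And>m. B m \<in> sets M" "indicat_real (B m) \<in> E"
    and w: "0 \<le> c" "c \<le> \<bar>w m\<bar>" and big: "1 < \<phi> c * ennreal (N (indicat_real (B m)))"
  shows "1 < modular M E N \<phi> (step_function B w)"
proof (rule ccontr)
  let ?f = "\<lambda>t. enn2real (\<phi> \<bar>step_function B w t\<bar>)"
  let ?r = "enn2real (\<phi> \<bar>w m\<bar>)" and ?n = "N (indicat_real (B m))"
  assume "\<not> 1 < modular M E N \<phi> (step_function B w)"
  then have "modular M E N \<phi> (step_function B w) \<le> 1" by simp
  then have fin: "AE t in M. \<phi> \<bar>step_function B w t\<bar> < \<infinity>" and f: "?f \<in> E" "N ?f \<le> 1"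
    by (auto simp: modular_def ennreal_le_1 top_unique split: if_splits)
  have on_B: "step_function B w t = w m" if "t \<in> B m" for t
    using step_function_eq[OF B(1) that] .
  have finite: "\<phi> \<bar>w m\<bar> < \<infinity>"
  proof (rule ccontr)
    assume "\<not> \<phi> \<bar>w m\<bar> < \<infinity>"
    have "AE t in M. indicat_real (B m) t = 0"
      using fin
    proof eventually_elim
      case (elim t)
      then show ?case using \<open>\<not> \<phi> \<bar>w m\<bar> < \<infinity>\<close> by (cases "t \<in> B m") (simp_all add: on_B)
    qed
    then have "?n = 0" using norm_eq_0_iff[OF B(3)] by blast
    then show False using big by simp
  qed
  have "(\<lambda>t. ?r * indicat_real (B m) t) \<in> L0 M" using B(2) by measurable
  then have "N (\<lambda>t. ?r * indicat_real (B m) t) \<le> N ?f"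
    using f(1) by (intro conjunct2[OF ideal] AE_I2) (auto simp: on_B indicator_def)
  then have "?r * ?n \<le> 1" using f(2) norm_scale[OF B(3), of ?r] by simp
  have "\<phi> c * ennreal ?n \<le> \<phi> \<bar>w m\<bar> * ennreal ?n"
    using orlicz_mono[OF \<phi> w] by (rule mult_right_mono) simp
  also have "\<dots> = ennreal (?r * ?n)"
    using finite norm_nonneg[OF B(3)] by (simp add: ennreal_mult)
  also have "\<dots> \<le> 1" using \<open>?r * ?n \<le> 1\<close> by (simp add: ennreal_le_1)
  finally show False using big by simp
qed

lemma exists_disjoint_sets_of_norm:
  assumes "sigma_finite_measure M" "nonatomic M" "\<not> Linf M \<subseteq> E" "fatou_property M E N"
    and "is_support M (order_continuous_part M E N) (space M)"
    and C: "C \<ge> 1" "\<And>x y. \<lbrakk>x \<in> E; y \<in> E\<rbrakk> \<Longrightarrow> N (\<lambda>t. x t + y t) \<le> C * (N x + N y)"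
    and s: "\<And>m::nat. s m > 0"
  obtains B where "disjoint_family B" "\<And>m. B m \<in> sets M" "\<And>m. indicat_real (B m) \<in> E"
    "\<And>m. s m / C \<le> N (indicat_real (B m))" "\<And>m. N (indicat_real (B m)) \<le> s m"
proof -
  (* F m is the union of the sets chosen before stage m; the new set is F (Suc m) - F m. *)
  have "\<exists>F. \<forall>m. (F m \<in> sets M \<and> indicat_real (F m) \<in> E) \<and> (F m \<subseteq> F (Suc m) \<and>
      indicat_real (F (Suc m) - F m) \<in> E \<and> s m / C \<le> N (indicat_real (F (Suc m) - F m)) \<and>
      N (indicat_real (F (Suc m) - F m)) \<le> s m)"
  proof (rule dependent_nat_choice)
    show "\<exists>F. F \<in> sets M \<and> indicat_real F \<in> E"
      using zero_mem by (intro exI[of _ "{}"]) (simp add: indicator_def[abs_def])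
  next
    fix F m assume F: "F \<in> sets M \<and> indicat_real F \<in> E"
    obtain D where D: "D \<in> sets M" "D \<inter> F = {}" "indicat_real D \<in> E"
      "s m / C \<le> N (indicat_real D)" "N (indicat_real D) \<le> s m"
      using exists_set_of_norm[where C = C and F = F and s = "s m", OF assms(1-5) C _ _ s[of m]] F by blast
    have "F \<union> D - F = D" using D(2) by blast
    then show "\<exists>F'. (F' \<in> sets M \<and> indicat_real F' \<in> E) \<and> (F \<subseteq> F' \<and>
        indicat_real (F' - F) \<in> E \<and> s m / C \<le> N (indicat_real (F' - F)) \<and>
        N (indicat_real (F' - F)) \<le> s m)"
      using F D indicator_union_mem[of F D] by (intro exI[of _ "F \<union> D"]) (simp add: sets.Un)
  qed
  then obtain F where F: "\<And>m. F m \<in> sets M" "\<And>m. F m \<subseteq> F (Suc m)"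
    and D: "\<And>m. indicat_real (F (Suc m) - F m) \<in> E"
      "\<And>m. s m / C \<le> N (indicat_real (F (Suc m) - F m))"
      "\<And>m. N (indicat_real (F (Suc m) - F m)) \<le> s m"
    by blast
  have "disjoint_family (\<lambda>m. F (Suc m) - F m)"
    using F(2) by (rule disjoint_family_Suc)
  with F D show thesis by (intro that[of "\<lambda>m. F (Suc m) - F m"]) auto
qed

end


section \<open>The copy of the bounded sequences\<close>

lemma orlicz_norm_eqI:
  assumes "0 \<le> c"
    and le: "\<And>r. \<lbrakk>0 < r; c \<le> r\<rbrakk> \<Longrightarrow> modular M E N \<phi> (\<lambda>t. x t / r) \<le> 1"
    and gt: "\<And>r. \<lbrakk>0 < r; r < c\<rbrakk> \<Longrightarrow> 1 < modular M E N \<phi> (\<lambda>t. x t / r)"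
  shows "orlicz_norm M E N \<phi> x = c"
proof -
  have "{r. r > 0 \<and> modular M E N \<phi> (\<lambda>t. x t / r) \<le> 1} = {r. 0 < r \<and> c \<le> r}"
  proof (rule Collect_cong)
    fix r
    show "(r > 0 \<and> modular M E N \<phi> (\<lambda>t. x t / r) \<le> 1) = (0 < r \<and> c \<le> r)"
      using le[of r] gt[of r] by (cases "c \<le> r"; cases "0 < r") (auto simp: not_le dest: leD)
  qed
  moreover have "Inf {r. 0 < r \<and> c \<le> r} = c"
  proof (cases "c = 0")
    case True
    have "{r::real. 0 < r \<and> 0 \<le> r} = {0<..}" by auto
    with True show ?thesis by simp
  next
    case False
    with assms(1) show ?thesis by (intro cInf_eq_minimum) auto
  qed
  ultimately show ?thesis by (simp only: orlicz_norm_def)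
qed

text \<open>
  The \<open>n\<close>-th coordinate of a sequence is placed on the infinitely many sets \<open>B m\<close> with
  \<open>fst (prod_decode m) = n\<close>. Among these are sets with arbitrarily large \<open>m\<close>, on which
  dilations by factors arbitrarily close to \<open>1\<close> already push the modular above \<open>1\<close>.
\<close>

lemma contains_linfty_if_step_functions:
  fixes M :: "'a measure"
  assumes B: "\<And>m. B m \<in> sets M" and u: "\<And>m. 0 < u m"
    and le: "\<And>w. (\<And>m. \<bar>w m\<bar> \<le> u m) \<Longrightarrow> modular M E N \<phi> (step_function B w) \<le> 1"
    and gt: "\<And>w m. (1 + 1 / Suc m) * u m \<le> \<bar>w m\<bar> \<Longrightarrow> 1 < modular M E N \<phi> (step_function B w)"
  shows "contains_order_isometric_linfty M (orlicz_space M E N \<phi>) (orlicz_norm M E N \<phi>)"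
proof -
  define h where "h m = fst (prod_decode m)" for m
  define P where "P z = step_function B (\<lambda>m. z (h m) * u m)" for z
  have scale: "(\<lambda>t. P z t / r) = step_function B (\<lambda>m. z (h m) * u m / r)" for z r
    by (auto simp: P_def step_function_def fun_eq_iff)
  have bound: "\<bar>z n\<bar> \<le> linfty_norm z" if "z \<in> linfty" for z n
  proof -
    have "bdd_above (range (\<lambda>n. \<bar>z n\<bar>))"
      using that by (auto simp: linfty_def bounded_iff bdd_above_def)
    then show ?thesis unfolding linfty_norm_def by (rule cSUP_upper[rotated]) simp
  qed
  have small: "modular M E N \<phi> (\<lambda>t. P z t / r) \<le> 1"
    if "z \<in> linfty" "0 < r" "linfty_norm z \<le> r" for z r
    unfolding scale
  proof (rule le)
    fix m
    have "\<bar>z (h m)\<bar> \<le> r" using bound[OF that(1), of "h m"] that(3) by linarith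
    then have le: "\<bar>z (h m)\<bar> * u m \<le> r * u m" using u[of m] by (intro mult_right_mono) auto
    have "\<bar>z (h m) * u m / r\<bar> = \<bar>z (h m)\<bar> * u m / r"
      using that(2) u[of m] by (simp add: abs_mult)
    also have "\<dots> \<le> r * u m / r" using le that(2) by (intro divide_right_mono) auto
    also have "\<dots> = u m" using that(2) by simp
    finally show "\<bar>z (h m) * u m / r\<bar> \<le> u m" .
  qed
  have large: "1 < modular M E N \<phi> (\<lambda>t. P z t / r)"
    if z: "z \<in> linfty" and r: "0 < r" "r < linfty_norm z" for z r
  proof -
    have "\<exists>n. r < \<bar>z n\<bar>"
    proof (rule ccontr)
      assume "\<nexists>n. r < \<bar>z n\<bar>"
      then have "linfty_norm z \<le> r"
        unfolding linfty_norm_def by (intro cSUP_least) (auto simp: not_less)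
      then show False using r(2) by simp
    qed
    then obtain n where n: "r < \<bar>z n\<bar>" by blast
    then have "\<bar>z n\<bar> / r - 1 > 0" using r(1) by simp
    then obtain k where k: "inverse (real (Suc k)) < \<bar>z n\<bar> / r - 1"
      using reals_Archimedean by blast
    define m where "m = prod_encode (n, k)"
    have m: "h m = n" "k \<le> m" by (simp_all add: m_def h_def le_prod_encode_2)
    have "1 / real (Suc m) \<le> inverse (real (Suc k))"
      using m(2) by (simp add: inverse_eq_divide frac_le)
    then have "1 + 1 / Suc m \<le> \<bar>z n\<bar> / r" using k by linarith
    then have "(1 + 1 / Suc m) * u m \<le> \<bar>z n\<bar> / r * u m"
      using u[of m] by (intro mult_right_mono) auto
    also have "\<dots> = \<bar>z (h m) * u m / r\<bar>" using r(1) u[of m] m(1) by (simp add: abs_mult)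
    finally show ?thesis unfolding scale by (rule gt)
  qed
  have nonneg: "0 \<le> linfty_norm z" if "z \<in> linfty" for z
    using bound[OF that, of 0] abs_ge_zero[of "z 0"] by linarith
  have mem: "P z \<in> orlicz_space M E N \<phi>" if z: "z \<in> linfty" for z
  proof -
    have "P z \<in> L0 M" unfolding P_def using B by (rule step_function_measurable)
    moreover have "modular M E N \<phi> (\<lambda>t. (1 / (linfty_norm z + 1)) * P z t) < \<infinity>"
      using small[OF z, of "linfty_norm z + 1"] nonneg[OF z]
      by (auto intro: le_less_trans[OF _ ennreal_one_less_top])
    moreover have "1 / (linfty_norm z + 1) > 0" using nonneg[OF z] by simp
    ultimately show ?thesis unfolding orlicz_space_def by blast
  qed
  have norm: "orlicz_norm M E N \<phi> (P z) = linfty_norm z" if "z \<in> linfty" for z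
    using nonneg small large that by (intro orlicz_norm_eqI)
  show ?thesis
    unfolding contains_order_isometric_linfty_def
  proof (intro exI[of _ P] conjI ballI allI AE_I2)
    show "\<bar>P z t\<bar> = P (\<lambda>n. \<bar>z n\<bar>) t" for z t
      using less_imp_le[OF u] by (simp add: P_def step_function_def abs_mult abs_of_nonneg)
  qed (use mem norm in \<open>auto simp: P_def step_function_def algebra_simps\<close>)
qed

theorem theorem5p3:
  fixes M :: "'a measure" and E :: "('a \<Rightarrow> real) set" and N :: "('a \<Rightarrow> real) \<Rightarrow> real"
    and \<phi> :: "real \<Rightarrow> ennreal"
  assumes "complete_measure M" and "sigma_finite_measure M" and "emeasure M (space M) > 0"
    and "quasi_banach_ideal_space M E N" and "fatou_property M E N"
    and "orlicz_function \<phi>" and "orlicz_a \<phi> < orlicz_b \<phi>" and "alpha_E M E \<phi> > 0"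
    and "nonatomic M" and "\<not> Linf M \<subseteq> E"
    and "is_support M (order_continuous_part M E N) (space M)"
    and "\<not> Delta2_at_0 \<phi>"
  shows "contains_order_isometric_linfty M (orlicz_space M E N \<phi>) (orlicz_norm M E N \<phi>)"
proof -
  interpret quasi_banach_ideal_space M E N by fact
  obtain C where C: "C \<ge> 1"
    "\<And>x y. \<lbrakk>x \<in> E; y \<in> E\<rbrakk> \<Longrightarrow> N (\<lambda>t. x t + y t) \<le> C * (N x + N y)"
    using quasi_triangle by blast
  (* Norms are matched only up to the factor C, so the lower target 2 * C leaves a value above 1. *)
  have "\<exists>u s. u > 0 \<and> s > 0 \<and> \<phi> u < \<infinity> \<and> \<phi> u * ennreal s \<le> ennreal ((1 / (2 * C)) ^ Suc m) \<and>
      ennreal (2 * C) \<le> \<phi> ((1 + 1 / real (Suc m)) * u) * ennreal s" for m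
    by (rule orlicz_scaled_jump[OF assms(6,7,12), of "1 + 1 / real (Suc m)"
          "(1 / (2 * C)) ^ Suc m" "2 * C"])
      (use C(1) in auto)
  then obtain u s where u: "\<And>m. u m > 0" "\<And>m. \<phi> (u m) < \<infinity>" and s: "\<And>m. s m > 0"
    and small: "\<And>m. \<phi> (u m) * ennreal (s m) \<le> ennreal ((1 / (2 * C)) ^ Suc m)"
    and large: "\<And>m. ennreal (2 * C) \<le> \<phi> ((1 + 1 / real (Suc m)) * u m) * ennreal (s m)"
    by metis
  obtain B where B: "disjoint_family B" "\<And>m. B m \<in> sets M" "\<And>m. indicat_real (B m) \<in> E"
    and norm_B: "\<And>m. s m / C \<le> N (indicat_real (B m))" "\<And>m. N (indicat_real (B m)) \<le> s m"
    using exists_disjoint_sets_of_norm[where s = s and C = C, OF assms(2,9,10,5,11) C s] by metis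
  show ?thesis
  proof (rule contains_linfty_if_step_functions)
    fix w :: "nat \<Rightarrow> real" assume w: "\<And>m. \<bar>w m\<bar> \<le> u m"
    show "modular M E N \<phi> (step_function B w) \<le> 1"
    proof (rule modular_step_function_le_1)
      fix m
      let ?p = "enn2real (\<phi> (u m))"
      have "ennreal (?p * s m) \<le> ennreal ((1 / (2 * C)) ^ Suc m)"
        using small[of m] u(2)[of m] s[of m] by (simp add: ennreal_mult)
      then have "?p * s m \<le> (1 / (2 * C)) ^ Suc m"
        using C(1) by (subst (asm) ennreal_le_iff) auto
      moreover have "?p * N (indicat_real (B m)) \<le> ?p * s m"
        using norm_B(2) by (intro mult_left_mono) auto
      ultimately show "?p * N (indicat_real (B m)) \<le> (1 / (2 * C)) ^ Suc m" by linarith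
    qed (fact assms C B u w)+
  next
    fix w :: "nat \<Rightarrow> real" and m
    let ?c = "(1 + 1 / real (Suc m)) * u m" and ?n = "N (indicat_real (B m))"
    assume w: "?c \<le> \<bar>w m\<bar>"
    have "1 < \<phi> ?c * ennreal ?n"
    proof (rule ccontr)
      assume "\<not> 1 < \<phi> ?c * ennreal ?n"
      then have le: "\<phi> ?c * ennreal ?n \<le> 1" by simp
      have "s m \<le> C * ?n" using norm_B(1)[of m] C(1) by (simp add: pos_divide_le_eq mult.commute)
      then have "ennreal (s m) \<le> ennreal C * ennreal ?n"
        using C(1) norm_nonneg[OF B(3)] by (simp add: ennreal_leI flip: ennreal_mult)
      then have "\<phi> ?c * ennreal (s m) \<le> \<phi> ?c * (ennreal C * ennreal ?n)"
        by (rule mult_left_mono) simp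
      also have "\<dots> = ennreal C * (\<phi> ?c * ennreal ?n)" by (simp add: ac_simps)
      also have "\<dots> \<le> ennreal C * 1" using le by (rule mult_left_mono) simp
      finally have "ennreal (2 * C) \<le> ennreal C" using large[of m] by simp
      then show False using C(1) by (simp add: ennreal_le_iff)
    qed
    moreover have "0 \<le> ?c" using u(1)[of m] by simp
    ultimately show "1 < modular M E N \<phi> (step_function B w)"
      using assms(6) B w by (intro modular_step_function_gt_1[where c = ?c and m = m])
  qed (fact B u)+
qed

end
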